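(* (1) For any $\mu,\lambda\in(0,1)$: $\mathbb{L}^{>0}(\mathrm{QBA}|\mathrm{ND})\subseteq\mathbb{L}^{>\mu}(\mathrm{QBA}|\mathrm{ND})=\mathbb{L}^{>\lambda}(\mathrm{QBA}|\mathrm{ND})$. (2) For any $\mu,\lambda\in(0,1)$: $\mathbb{L}^{=1}(\mathrm{QBA}|\mathrm{ND})\subseteq\mathbb{L}^{\ge\mu}(\mathrm{QBA}|\mathrm{ND})=\mathbb{L}^{\ge\lambda}(\mathrm{QBA}|\mathrm{ND})$. (3) For any $\lambda\in[0,1)$: $\mathbb{L}^{=1}(\mathrm{QBA}|\mathrm{ND})\not\subseteq\mathbb{L}^{>\lambda}(\mathrm{QBA}|\mathrm{ND})$.
   Context: A quantum automaton is a tuple $\mathcal{A}=(\mathcal{H},|s_0\rangle,\Sigma,\{U_\sigma:\sigma\in\Sigma\},F)$ where $\mathcal{H}$ is a finite-dimensional complex Hilbert space, $|s_0\rangle$ a unit vector, $\Sigma$ a finite alphabet, each $U_\sigma$ unitary, and $F$ a subspace. For $w\in\Sigma^\omega$ with length-$n$ prefixes $w_n$, the non-disturbing run is $|s_n\rangle=U_{w_n}|s_0\rangle$ where $U_{\sigma_1\cdots\sigma_m}=U_{\sigma_m}\cdots U_{\sigma_1}$, and $f^{\mathrm{ND}}_{\mathcal{A}}(w)=\sup_{|\psi\rangle\in F,\||\psi\rangle\|=1}\sup_{\{n_i\}}\inf_{i\ge1}|\langle\psi|s_{n_i}\rangle|^2$ over strictly increasing sequences $0\le n_1<n_2<\cdots$.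 Languages: $\mathcal{L}^{>0}(\mathcal{A}|\mathrm{ND})=\{w: f^{\mathrm{ND}}_{\mathcal{A}}(w)>0\}$, $\mathcal{L}^{=1}(\mathcal{A}|\mathrm{ND})=\{w:f^{\mathrm{ND}}_{\mathcal{A}}(w)=1\}$, $\mathcal{L}^{>\lambda}(\mathcal{A}|\mathrm{ND})=\{w:f^{\mathrm{ND}}_{\mathcal{A}}(w)>\lambda\}$, $\mathcal{L}^{\ge\lambda}(\mathcal{A}|\mathrm{ND})=\{w:f^{\mathrm{ND}}_{\mathcal{A}}(w)\ge\lambda\}$ (subsets of $\Sigma^\omega$). For each such semantics $\bowtie$, $\mathbb{L}^{\bowtie}(\mathrm{QBA}|\mathrm{ND})$ is the class of all languages $\mathcal{L}^{\bowtie}(\mathcal{A}|\mathrm{ND})$ as $\mathcal{A}$ ranges over all quantum automata. *)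

theory Defs
  imports "Jordan_Normal_Form.Matrix" "Jordan_Normal_Form.Conjugate"
begin

text \<open>Quantum automata over alphabet symbols drawn from nat.  The Hilbert space is
  complex^d (carrier_vec d); the alphabet is a finite nonempty set of naturals.\<close>

record qa =
  qdim   :: nat
  qinit  :: "complex vec"
  qalph  :: "nat set"
  qU     :: "nat \<Rightarrow> complex mat"
  qF     :: "complex vec set"

definition adjoint_mat :: "complex mat \<Rightarrow> complex mat" where
  "adjoint_mat U = mat (dim_col U) (dim_row U) (\<lambda>(i,j). cnj (U $$ (j,i)))"

definition unitary_mat :: "nat \<Rightarrow> complex mat \<Rightarrow> bool" where
  "unitary_mat d U \<longleftrightarrow> U \<in> carrier_mat d d \<and> U * adjoint_mat U = 1\<^sub>m d
      \<and> adjoint_mat U * U = 1\<^sub>m d"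

definition is_subspace :: "nat \<Rightarrow> complex vec set \<Rightarrow> bool" where
  "is_subspace d F \<longleftrightarrow> F \<subseteq> carrier_vec d \<and> 0\<^sub>v d \<in> F
      \<and> (\<forall>u\<in>F. \<forall>v\<in>F. u + v \<in> F) \<and> (\<forall>c. \<forall>v\<in>F. c \<cdot>\<^sub>v v \<in> F)"

definition unit_vec :: "complex vec \<Rightarrow> bool" where
  "unit_vec v \<longleftrightarrow> v \<bullet>c v = 1"

definition wf_qa :: "qa \<Rightarrow> bool" where
  "wf_qa A \<longleftrightarrow> finite (qalph A) \<and> qalph A \<noteq> {}
     \<and> qinit A \<in> carrier_vec (qdim A) \<and> unit_vec (qinit A)
     \<and> (\<forall>\<sigma>\<in>qalph A. unitary_mat (qdim A) (qU A \<sigma>))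
     \<and> is_subspace (qdim A) (qF A)"

text \<open>Non-disturbing run: s_0 = initial state, s_(n+1) = U_(w n) s_n
  (so s_n = U_(w_(n-1)) ... U_(w_0) s_0).\<close>
fun run :: "qa \<Rightarrow> (nat \<Rightarrow> nat) \<Rightarrow> nat \<Rightarrow> complex vec" where
  "run A w 0 = qinit A"
| "run A w (Suc n) = qU A (w n) *\<^sub>v run A w n"

text \<open>|<psi|s>|^2 ; note  s \<bullet>c psi = sum_i s_i * cnj(psi_i) = <psi|s>.\<close>
definition overlap :: "complex vec \<Rightarrow> complex vec \<Rightarrow> real" where
  "overlap psi s = (cmod (s \<bullet>c psi))\<^sup>2"

text \<open>f^ND. The outer supremum over unit psi in F is taken together with 0, i.e. the
  supremum of the empty set is read as 0 (only relevant when F = 0).\<close>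
definition fND :: "qa \<Rightarrow> (nat \<Rightarrow> nat) \<Rightarrow> real" where
  "fND A w = Sup (insert (0::real)
     {Inf (range (\<lambda>i::nat. overlap psi (run A w (r i)))) | (psi :: complex vec) (r :: nat \<Rightarrow> nat).
        psi \<in> qF A \<and> unit_vec psi \<and> strict_mono r})"

definition is_word :: "nat set \<Rightarrow> (nat \<Rightarrow> nat) \<Rightarrow> bool" where
  "is_word \<Sigma> w \<longleftrightarrow> (\<forall>i. w i \<in> \<Sigma>)"

text \<open>The language accepted under the threshold predicate P (e.g. (\<lambda>x. x > 0)),
  paired with its alphabet.\<close>
definition lang :: "(real \<Rightarrow> bool) \<Rightarrow> qa \<Rightarrow> nat set \<times> (nat \<Rightarrow> nat) set" where
  "lang P A = (qalph A, {w. is_word (qalph A) w \<and> P (fND A w)})"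

definition QBA_class :: "(real \<Rightarrow> bool) \<Rightarrow> (nat set \<times> (nat \<Rightarrow> nat) set) set" where
  "QBA_class P = {lang P A | A. wf_qa A}"

end

(* Padding an automaton A by one dimension, with initial state sqrt p s0 + sqrt (1 - p) e for a new
   basis vector e that every letter fixes, turns the acceptance value f into p f if e is not
   accepting and into p f + (1 - p) if it is; for the lower bound in the second case psi is aligned
   with a limit point of the overlaps. These affine maps move any threshold in [0, 1] to any
   threshold in (0, 1), for strict and non-strict comparison alike, and value 1 is threshold 1
   because f <= 1. This gives (1) and (2).

   For (3), let letter 0 rotate a relative phase in C^2 by 2 pi theta, theta irrational, and let
   letter 1 act trivially. By Kronecker's theorem 0^omega has value 1, whereas every word ending in
   1^omega has value < 1. If B accepted the same language with threshold lambda, some witness psi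
   has overlap > lambda with the run of B on 0^omega at a time m. Switch the word to 1^omega after
   m: the orbit of the unitary of letter 1 returns arbitrarily close to the state at time m
   infinitely often, so B still accepts, a contradiction. *)

theory Submission
  imports Defs "HOL-Analysis.Kronecker_Approximation_Theorem"
begin

hide_type (open) Finite_Cartesian_Product.vec
hide_const (open) Finite_Cartesian_Product.vec Finite_Cartesian_Product.mat Finite_Cartesian_Product.vec_nth
no_notation Finite_Cartesian_Product.vec_nth (infixl "$" 90)

section \<open>Inner products and unitary matrices\<close>

lemma cscalar_prod_eq_sum: "u \<in> carrier_vec d \<Longrightarrow> v \<bullet>c u = (\<Sum>i<d. v $ i * cnj (u $ i))"
  by (auto simp: scalar_prod_def lessThan_atLeast0 intro!: sum.cong)

lemma mult_mat_vec_index_sum: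
  "U \<in> carrier_mat n d \<Longrightarrow> x \<in> carrier_vec d \<Longrightarrow> i < n \<Longrightarrow> (U *\<^sub>v x) $ i = (\<Sum>j<d. U $$ (i, j) * x $ j)"
  by (auto simp: scalar_prod_def lessThan_atLeast0 row_def intro!: sum.cong)

lemma mult_mat_index_sum:
  "A \<in> carrier_mat n m \<Longrightarrow> B \<in> carrier_mat m k \<Longrightarrow> i < n \<Longrightarrow> j < k \<Longrightarrow>
   (A * B) $$ (i, j) = (\<Sum>l<m. A $$ (i, l) * B $$ (l, j))"
  by (auto simp: scalar_prod_def lessThan_atLeast0 row_def col_def intro!: sum.cong)

lemma adjoint_mat_carrier: "U \<in> carrier_mat n d \<Longrightarrow> adjoint_mat U \<in> carrier_mat d n"
  by (simp add: adjoint_mat_def)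

lemma cscalar_prod_mult_mat_vec_left:
  assumes "U \<in> carrier_mat n d" "x \<in> carrier_vec d" "y \<in> carrier_vec n"
  shows "(U *\<^sub>v x) \<bullet>c y = x \<bullet>c (adjoint_mat U *\<^sub>v y)"
proof -
  have "(U *\<^sub>v x) \<bullet>c y = (\<Sum>i<n. \<Sum>j<d. x $ j * (U $$ (i, j) * cnj (y $ i)))"
    using assms by (simp add: cscalar_prod_eq_sum[of _ n] mult_mat_vec_index_sum sum_distrib_left mult_ac
        del: index_mult_mat_vec)
  also have "\<dots> = (\<Sum>j<d. x $ j * cnj (\<Sum>i<n. cnj (U $$ (i, j)) * y $ i))"
    by (subst sum.swap) (simp add: sum_distrib_left cnj_sum)
  also have "\<dots> = x \<bullet>c (adjoint_mat U *\<^sub>v y)"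
    using assms adjoint_mat_carrier[OF assms(1)]
    by (simp add: cscalar_prod_eq_sum[of _ d] mult_mat_vec_index_sum del: index_mult_mat_vec)
      (simp add: adjoint_mat_def)
  finally show ?thesis .
qed

lemma unitary_mat_carrier: "unitary_mat d U \<Longrightarrow> U \<in> carrier_mat d d"
  by (simp add: unitary_mat_def)

lemma unitary_mat_cscalar_prod:
  assumes U: "unitary_mat d U" and x: "x \<in> carrier_vec d" and y: "y \<in> carrier_vec d"
  shows "(U *\<^sub>v x) \<bullet>c (U *\<^sub>v y) = x \<bullet>c y"
proof -
  have Uc: "U \<in> carrier_mat d d" using U by (rule unitary_mat_carrier)
  have "(U *\<^sub>v x) \<bullet>c (U *\<^sub>v y) = x \<bullet>c ((adjoint_mat U * U) *\<^sub>v y)"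
    using Uc x y adjoint_mat_carrier[OF Uc] by (simp add: cscalar_prod_mult_mat_vec_left)
  also have "\<dots> = x \<bullet>c y"
    using U y by (simp add: unitary_mat_def)
  finally show ?thesis .
qed

lemma cscalar_prod_self_eq_sum:
  "u \<in> carrier_vec d \<Longrightarrow> u \<bullet>c u = of_real (\<Sum>i<d. (cmod (u $ i))\<^sup>2)"
  by (simp add: cscalar_prod_eq_sum of_real_sum flip: complex_norm_square)

lemma unit_vec_sum_norm: "u \<in> carrier_vec d \<Longrightarrow> unit_vec u \<Longrightarrow> (\<Sum>i<d. (cmod (u $ i))\<^sup>2) = 1"
  using cscalar_prod_self_eq_sum[of u d] unfolding unit_vec_def by (metis of_real_eq_1_iff)

lemma unit_vec_norm_index_le_1:
  assumes "u \<in> carrier_vec d" "unit_vec u" "i < d"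
  shows "cmod (u $ i) \<le> 1"
proof -
  have "(cmod (u $ i))\<^sup>2 \<le> (\<Sum>i<d. (cmod (u $ i))\<^sup>2)"
    by (rule member_le_sum) (use assms in auto)
  then show ?thesis using unit_vec_sum_norm[OF assms(1,2)] by (simp add: power_le_one_iff)
qed

lemma norm_cscalar_prod_unit_le_1:
  assumes "u \<in> carrier_vec d" "unit_vec u" "v \<in> carrier_vec d" "unit_vec v"
  shows "cmod (v \<bullet>c u) \<le> 1"
proof -
  have "cmod (v \<bullet>c u) \<le> (\<Sum>i<d. cmod (v $ i) * cmod (u $ i))"
    using assms(1) by (simp add: cscalar_prod_eq_sum norm_mult sum_norm_le)
  also have "\<dots> \<le> (\<Sum>i<d. ((cmod (v $ i))\<^sup>2 + (cmod (u $ i))\<^sup>2) / 2)"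
  proof (rule sum_mono)
    fix i
    have "0 \<le> (cmod (v $ i) - cmod (u $ i))\<^sup>2" by simp
    then show "cmod (v $ i) * cmod (u $ i) \<le> ((cmod (v $ i))\<^sup>2 + (cmod (u $ i))\<^sup>2) / 2"
      by (simp add: power2_diff)
  qed
  also have "\<dots> = 1"
    using assms by (simp add: sum.distrib unit_vec_sum_norm flip: sum_divide_distrib)
  finally show ?thesis .
qed

lemma overlap_nonneg: "0 \<le> overlap psi s"
  by (simp add: overlap_def)

lemma overlap_le_1:
  "psi \<in> carrier_vec d \<Longrightarrow> unit_vec psi \<Longrightarrow> s \<in> carrier_vec d \<Longrightarrow> unit_vec s \<Longrightarrow> overlap psi s \<le> 1"
  unfolding overlap_def by (simp add: power_le_one norm_cscalar_prod_unit_le_1)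

lemma norm_power2_diff_le:
  fixes x y :: "'a::real_normed_vector"
  assumes "norm x \<le> 1" "norm y \<le> 1"
  shows "\<bar>(norm x)\<^sup>2 - (norm y)\<^sup>2\<bar> \<le> 2 * norm (x - y)"
proof -
  have "(norm x)\<^sup>2 - (norm y)\<^sup>2 = (norm x - norm y) * (norm x + norm y)"
    by (simp add: power2_eq_square algebra_simps)
  then have "\<bar>(norm x)\<^sup>2 - (norm y)\<^sup>2\<bar> = \<bar>norm x - norm y\<bar> * (norm x + norm y)"
    by (simp add: abs_mult)
  also have "\<dots> \<le> norm (x - y) * 2"
    using assms by (intro mult_mono norm_triangle_ineq3) auto
  finally show ?thesis by simp
qed

section \<open>Runs and the acceptance value\<close>

lemma qU_unitary: "wf_qa A \<Longrightarrow> \<sigma> \<in> qalph A \<Longrightarrow> unitary_mat (qdim A) (qU A \<sigma>)"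
  by (simp add: wf_qa_def)

lemma qF_carrier: "wf_qa A \<Longrightarrow> psi \<in> qF A \<Longrightarrow> psi \<in> carrier_vec (qdim A)"
  unfolding wf_qa_def is_subspace_def by auto

lemma run_carrier_unit:
  assumes "wf_qa A" "is_word (qalph A) w"
  shows "run A w n \<in> carrier_vec (qdim A) \<and> unit_vec (run A w n)"
proof (induction n)
  case 0
  then show ?case using assms(1) by (simp add: wf_qa_def)
next
  case (Suc n)
  have U: "unitary_mat (qdim A) (qU A (w n))"
    using assms by (simp add: qU_unitary is_word_def)
  then show ?case
    using Suc unitary_mat_cscalar_prod[OF U] unitary_mat_carrier[OF U] by (auto simp: unit_vec_def)
qed

lemma overlap_run_le_1:
  "wf_qa A \<Longrightarrow> is_word (qalph A) w \<Longrightarrow> psi \<in> qF A \<Longrightarrow> unit_vec psi \<Longrightarrow> overlap psi (run A w n) \<le> 1"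
  using overlap_le_1 qF_carrier run_carrier_unit by blast

lemma Inf_overlap_le: "Inf (range (\<lambda>i. overlap psi (s i))) \<le> overlap psi (s i)"
  by (rule cINF_lower) (auto intro: bdd_belowI2 overlap_nonneg)

definition nd_values :: "qa \<Rightarrow> (nat \<Rightarrow> nat) \<Rightarrow> real set" where
  "nd_values A w = {Inf (range (\<lambda>i. overlap psi (run A w (r i)))) | (psi :: complex vec) (r :: nat \<Rightarrow> nat).
     psi \<in> qF A \<and> unit_vec psi \<and> strict_mono r}"

lemma fND_eq_Sup_nd_values: "fND A w = Sup (insert 0 (nd_values A w))"
  unfolding fND_def nd_values_def ..

lemma bdd_above_nd_values:
  assumes "wf_qa A" "is_word (qalph A) w"
  shows "bdd_above (insert 0 (nd_values A w))"
proof (rule bdd_aboveI)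
  fix x assume "x \<in> insert 0 (nd_values A w)"
  then show "x \<le> 1"
  proof
    assume "x \<in> nd_values A w"
    then obtain psi and r :: "nat \<Rightarrow> nat" where x: "x = Inf (range (\<lambda>i. overlap psi (run A w (r i))))"
      and psi: "psi \<in> qF A" "unit_vec psi"
      by (auto simp: nd_values_def)
    show "x \<le> 1"
      unfolding x using Inf_overlap_le overlap_run_le_1[OF assms psi] by (rule order_trans)
  qed simp
qed

lemma fND_nonneg: "wf_qa A \<Longrightarrow> is_word (qalph A) w \<Longrightarrow> 0 \<le> fND A w"
  unfolding fND_eq_Sup_nd_values by (rule cSup_upper[OF insertI1 bdd_above_nd_values])

lemma fND_leI:
  assumes "\<And>psi (r :: nat \<Rightarrow> nat). psi \<in> qF A \<Longrightarrow> unit_vec psi \<Longrightarrow> strict_mono r \<Longrightarrow>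
      Inf (range (\<lambda>i. overlap psi (run A w (r i)))) \<le> c"
    and "0 \<le> c"
  shows "fND A w \<le> c"
  unfolding fND_eq_Sup_nd_values by (rule cSup_least) (use assms in \<open>auto simp: nd_values_def\<close>)

lemma fND_le_1: "wf_qa A \<Longrightarrow> is_word (qalph A) w \<Longrightarrow> fND A w \<le> 1"
  by (rule fND_leI) (auto intro: order_trans[OF Inf_overlap_le[where i=0] overlap_run_le_1])

lemma Inf_overlap_le_fND:
  fixes r :: "nat \<Rightarrow> nat"
  assumes "wf_qa A" "is_word (qalph A) w" "psi \<in> qF A" "unit_vec psi" "strict_mono r"
  shows "Inf (range (\<lambda>i. overlap psi (run A w (r i)))) \<le> fND A w"
  unfolding fND_eq_Sup_nd_values
  by (rule cSup_upper[OF _ bdd_above_nd_values[OF assms(1,2)]])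
    (use assms in \<open>auto simp: nd_values_def\<close>)

lemma fND_gtE:
  assumes "wf_qa A" "is_word (qalph A) w" "l < fND A w" "0 \<le> l"
  obtains psi and r :: "nat \<Rightarrow> nat" where "psi \<in> qF A" "unit_vec psi" "strict_mono r"
    "l < Inf (range (\<lambda>i. overlap psi (run A w (r i))))"
proof -
  obtain x where "x \<in> insert 0 (nd_values A w)" "l < x"
    using assms(3) less_cSup_iff[OF _ bdd_above_nd_values[OF assms(1,2)]]
    unfolding fND_eq_Sup_nd_values by blast
  then show ?thesis using assms(4) that by (auto simp: nd_values_def)
qed

text \<open>Since the supremum over subsequences of the infimum is the limit superior, a lower bound
  for the acceptance value only needs overlaps that exceed it infinitely often.\<close>

lemma le_fND_if_frequently:
  assumes A: "wf_qa A" "is_word (qalph A) w" and psi: "psi \<in> qF A" "unit_vec psi"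
    and freq: "\<And>e. 0 < e \<Longrightarrow> \<exists>\<^sub>F n in sequentially. c - e < overlap psi (run A w n)"
  shows "c \<le> fND A w"
proof (rule field_le_epsilon)
  fix e :: real assume "0 < e"
  then have "infinite {n. c - e < overlap psi (run A w n)}"
    using freq by (simp add: frequently_cofinite flip: cofinite_eq_sequentially)
  then obtain r :: "nat \<Rightarrow> nat" where r: "strict_mono r" "\<And>i. c - e < overlap psi (run A w (r i))"
    using infinite_enumerate by blast
  have "c - e \<le> Inf (range (\<lambda>i. overlap psi (run A w (r i))))"
    by (rule cINF_greatest) (auto intro: less_imp_le r(2))
  also have "\<dots> \<le> fND A w"
    by (rule Inf_overlap_le_fND[OF A psi r(1)])
  finally show "c \<le> fND A w + e" by simp
qed

lemma frequently_of_strict_mono: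
  assumes "strict_mono r" "\<forall>\<^sub>F k in sequentially. P (r k)"
  shows "\<exists>\<^sub>F n in sequentially. P n"
  unfolding frequently_sequentially
proof
  fix N
  obtain K where "\<And>k. K \<le> k \<Longrightarrow> P (r k)"
    using assms(2) unfolding eventually_sequentially by blast
  then show "\<exists>n\<ge>N. P n"
    using seq_suble[OF assms(1), of "max K N"] by (intro exI[of _ "r (max K N)"]) auto
qed

section \<open>Recurrence of unitary orbits\<close>

lemma convergent_coords_subseq:
  fixes X :: "nat \<Rightarrow> nat \<Rightarrow> complex"
  assumes "\<And>k i. i < d \<Longrightarrow> cmod (X k i) \<le> 1"
  shows "\<exists>g. strict_mono g \<and> (\<forall>i<d. \<exists>L. (\<lambda>k. X (g k) i) \<longlonglongrightarrow> L)"
  using assms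
proof (induction d)
  case 0
  show ?case by (rule exI[of _ id]) (simp add: strict_mono_def)
next
  case (Suc d)
  then obtain g where g: "strict_mono g" "\<forall>i<d. \<exists>L. (\<lambda>k. X (g k) i) \<longlonglongrightarrow> L"
    by force
  have "bounded (range (\<lambda>k. X (g k) d))"
    using Suc.prems[of d] by (intro boundedI[of _ 1]) auto
  then obtain L h where h: "strict_mono h" "((\<lambda>k. X (g k) d) \<circ> h) \<longlonglongrightarrow> L"
    using bounded_imp_convergent_subsequence by blast
  have "\<exists>L. (\<lambda>k. X (g (h k)) i) \<longlonglongrightarrow> L" if "i < Suc d" for i
  proof (cases "i = d")
    case True
    then show ?thesis using h(2) by (auto simp: o_def)
  next
    case False
    then have "i < d" using \<open>i < Suc d\<close> by simp
    then obtain L' where "(\<lambda>k. X (g k) i) \<longlonglongrightarrow> L'"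
      using g(2) by blast
    from LIMSEQ_subseq_LIMSEQ[OF this h(1)] show ?thesis by (auto simp: o_def)
  qed
  moreover have "strict_mono (g \<circ> h)"
    using g(1) h(1) by (rule strict_mono_o)
  ultimately show ?case by auto
qed

lemma funpow_unitary_carrier:
  "unitary_mat d U \<Longrightarrow> x \<in> carrier_vec d \<Longrightarrow> ((*\<^sub>v) U ^^ k) x \<in> carrier_vec d"
  by (induction k) (auto simp: unitary_mat_def)

lemma funpow_unitary_cscalar_prod:
  "unitary_mat d U \<Longrightarrow> x \<in> carrier_vec d \<Longrightarrow> y \<in> carrier_vec d \<Longrightarrow>
   ((*\<^sub>v) U ^^ k) x \<bullet>c ((*\<^sub>v) U ^^ k) y = x \<bullet>c y"
  by (induction k) (simp_all add: unitary_mat_cscalar_prod funpow_unitary_carrier)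

lemma funpow_unitary_unit_vec:
  "unitary_mat d U \<Longrightarrow> x \<in> carrier_vec d \<Longrightarrow> unit_vec x \<Longrightarrow> unit_vec (((*\<^sub>v) U ^^ k) x)"
  by (simp add: unit_vec_def funpow_unitary_cscalar_prod)

lemma norm_cscalar_prod_diff_le:
  assumes "x \<in> carrier_vec d" "y \<in> carrier_vec d" "q \<in> carrier_vec d" "unit_vec q"
    and close: "\<And>i. i < d \<Longrightarrow> cmod (x $ i - y $ i) \<le> \<delta>"
  shows "cmod (x \<bullet>c q - y \<bullet>c q) \<le> d * \<delta>"
proof -
  have "cmod (x \<bullet>c q - y \<bullet>c q) = cmod (\<Sum>i<d. (x $ i - y $ i) * cnj (q $ i))"
    using assms(3) by (simp add: cscalar_prod_eq_sum sum_subtractf left_diff_distrib)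
  also have "\<dots> \<le> (\<Sum>i<d. cmod (x $ i - y $ i) * cmod (q $ i))"
    by (simp add: norm_mult sum_norm_le)
  also have "\<dots> \<le> (\<Sum>i<d. \<delta> * 1)"
  proof (rule sum_mono)
    fix i assume "i \<in> {..<d}"
    then have "cmod (x $ i - y $ i) \<le> \<delta>" "cmod (q $ i) \<le> 1"
      using close unit_vec_norm_index_le_1[OF assms(3,4)] by auto
    then show "cmod (x $ i - y $ i) * cmod (q $ i) \<le> \<delta> * 1"
      by (intro mult_mono) (auto intro: order_trans[OF norm_ge_zero])
  qed
  finally show ?thesis by simp
qed

text \<open>A subsequence of the orbit of v converges; shifting by U^(g M) turns closeness of two late
  orbit points into closeness of an orbit point to v itself.\<close>

lemma unitary_recurrence:
  assumes U: "unitary_mat d U" and v: "v \<in> carrier_vec d" "unit_vec v"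
    and psi: "psi \<in> carrier_vec d" "unit_vec psi" and e: "0 < e"
  shows "\<exists>\<^sub>F k in sequentially. cmod (((*\<^sub>v) U ^^ k) v \<bullet>c psi - v \<bullet>c psi) < e"
  unfolding frequently_sequentially
proof
  fix N
  define X where "X k = ((*\<^sub>v) U ^^ k) v" for k
  have X: "X k \<in> carrier_vec d" "unit_vec (X k)" for k
    unfolding X_def using funpow_unitary_carrier[OF U v(1)] funpow_unitary_unit_vec[OF U v] by auto
  obtain g where g: "strict_mono g" "\<forall>i<d. \<exists>L. (\<lambda>k. X (g k) $ i) \<longlonglongrightarrow> L"
    using convergent_coords_subseq[of d "\<lambda>k i. X k $ i"] unit_vec_norm_index_le_1[OF X] by blast
  then obtain L where L: "\<And>i. i < d \<Longrightarrow> (\<lambda>k. X (g k) $ i) \<longlonglongrightarrow> L i"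
    by metis
  define \<delta> where "\<delta> = e / (real d + 1)"
  have \<delta>: "0 < \<delta>" "real d * \<delta> < e"
    using e by (auto simp: \<delta>_def field_simps)
  have "\<forall>\<^sub>F k in sequentially. \<forall>i\<in>{..<d}. dist (X (g k) $ i) (L i) < \<delta> / 2"
  proof (intro eventually_ball_finite ballI)
    fix i assume "i \<in> {..<d}"
    then show "\<forall>\<^sub>F k in sequentially. dist (X (g k) $ i) (L i) < \<delta> / 2"
      using L \<delta>(1) by (intro tendstoD) auto
  qed simp
  then obtain M where M: "\<And>k i. M \<le> k \<Longrightarrow> i < d \<Longrightarrow> dist (X (g k) $ i) (L i) < \<delta> / 2"
    unfolding eventually_sequentially by auto
  define b where "b = g M + N + 1"
  have "M \<le> b"
    using seq_suble[OF g(1), of M] by (simp add: b_def)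
  have "b \<le> g b"
    using seq_suble[OF g(1)] .
  define k where "k = g b - g M"
  have k: "N \<le> k" "g b = g M + k"
    using \<open>b \<le> g b\<close> by (auto simp: k_def b_def)
  define q where "q = ((*\<^sub>v) U ^^ g M) psi"
  have q: "q \<in> carrier_vec d" "unit_vec q"
    unfolding q_def using funpow_unitary_carrier[OF U psi(1)] funpow_unitary_unit_vec[OF U psi] by auto
  have "X k \<bullet>c psi = X (g b) \<bullet>c q" "v \<bullet>c psi = X (g M) \<bullet>c q"
    unfolding X_def q_def k(2) funpow_add o_def
    using funpow_unitary_cscalar_prod[OF U _ psi(1)] funpow_unitary_carrier[OF U v(1)] v(1) by auto
  moreover have "cmod (X (g b) $ i - X (g M) $ i) \<le> \<delta>" if "i < d" for i
    using dist_triangle_half_l[OF M[OF \<open>M \<le> b\<close> that] M[OF order_refl that]]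
    by (simp add: dist_norm)
  ultimately have "cmod (X k \<bullet>c psi - v \<bullet>c psi) \<le> d * \<delta>"
    using norm_cscalar_prod_diff_le[OF X(1) X(1) q] by simp
  then show "\<exists>k\<ge>N. cmod (((*\<^sub>v) U ^^ k) v \<bullet>c psi - v \<bullet>c psi) < e"
    using k(1) \<delta>(2) unfolding X_def by (intro exI[of _ k]) auto
qed

lemma run_const_suffix:
  assumes "\<forall>j\<ge>m. w j = b"
  shows "run A w (k + m) = ((*\<^sub>v) (qU A b) ^^ k) (run A w m)"
  using assms by (induction k) auto

lemma overlap_le_fND_const_suffix:
  assumes A: "wf_qa A" "is_word (qalph A) w" and suffix: "\<forall>j\<ge>m. w j = b"
    and psi: "psi \<in> qF A" "unit_vec psi"
  shows "overlap psi (run A w m) \<le> fND A w"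
proof (rule le_fND_if_frequently[OF A psi])
  fix e :: real assume "0 < e"
  define U where "U = qU A b"
  define v where "v = run A w m"
  have U: "unitary_mat (qdim A) U"
    using A suffix unfolding U_def is_word_def by (metis order_refl qU_unitary)
  have v: "v \<in> carrier_vec (qdim A)" "unit_vec v"
    using run_carrier_unit[OF A] by (auto simp: v_def)
  have psic: "psi \<in> carrier_vec (qdim A)"
    using qF_carrier[OF A(1) psi(1)] .
  have "\<exists>\<^sub>F k in sequentially. cmod (((*\<^sub>v) U ^^ k) v \<bullet>c psi - v \<bullet>c psi) < e / 2"
    by (rule unitary_recurrence[OF U v psic psi(2)]) (use \<open>0 < e\<close> in simp)
  then have "\<exists>\<^sub>F k in sequentially. overlap psi v - e < overlap psi (run A w (k + m))"
  proof (rule frequently_elim1)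
    fix k assume close: "cmod (((*\<^sub>v) U ^^ k) v \<bullet>c psi - v \<bullet>c psi) < e / 2"
    have "\<bar>overlap psi (((*\<^sub>v) U ^^ k) v) - overlap psi v\<bar> \<le> 2 * cmod (((*\<^sub>v) U ^^ k) v \<bullet>c psi - v \<bullet>c psi)"
      unfolding overlap_def
      using norm_cscalar_prod_unit_le_1[OF psic psi(2)] funpow_unitary_carrier[OF U v(1)]
        funpow_unitary_unit_vec[OF U v] v
      by (intro norm_power2_diff_le) auto
    then show "overlap psi v - e < overlap psi (run A w (k + m))"
      using close by (simp add: run_const_suffix[OF suffix] U_def v_def)
  qed
  then show "\<exists>\<^sub>F n in sequentially. overlap psi (run A w m) - e < overlap psi (run A w n)"
    unfolding v_def frequently_def
    using eventually_sequentially_seg[where P = "\<lambda>n. \<not> overlap psi (run A w m) - e < overlap psi (run A w n)"]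
    by blast
qed

section \<open>An irrational rotation\<close>

definition rotation_mat :: "real \<Rightarrow> complex mat" where
  "rotation_mat \<theta> = mat 2 2 (\<lambda>(i, j). if i \<noteq> j then 0 else if i = 0 then 1 else cis (2 * pi * \<theta>))"

definition inv_sqrt2 :: complex where
  "inv_sqrt2 = of_real (1 / sqrt 2)"

definition rotation_qa :: "real \<Rightarrow> qa" where
  "rotation_qa \<theta> = \<lparr>qdim = 2, qinit = vec 2 (\<lambda>i. if i = 0 then inv_sqrt2 else - inv_sqrt2),
     qalph = {0, 1}, qU = (\<lambda>\<sigma>. if \<sigma> = 0 then rotation_mat \<theta> else 1\<^sub>m 2),
     qF = {v \<in> carrier_vec 2. v $ 0 = v $ 1}\<rparr>"

fun count_zeros :: "(nat \<Rightarrow> nat) \<Rightarrow> nat \<Rightarrow> nat" where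
  "count_zeros w 0 = 0"
| "count_zeros w (Suc n) = count_zeros w n + (if w n = 0 then 1 else 0)"

lemma sum_lessThan_2: "(\<Sum>i<2. f i) = f 0 + f (1 :: nat)"
  by (simp add: numeral_2_eq_2)

lemma inv_sqrt2_mult_cnj: "inv_sqrt2 * cnj inv_sqrt2 = 1 / 2"
  by (simp add: inv_sqrt2_def flip: of_real_mult)

lemma unitary_one_mat: "unitary_mat d (1\<^sub>m d)"
proof -
  have "adjoint_mat (1\<^sub>m d) = 1\<^sub>m d"
    by (auto simp: adjoint_mat_def)
  then show ?thesis by (simp add: unitary_mat_def)
qed

lemma unitary_rotation_mat: "unitary_mat 2 (rotation_mat \<theta>)"
proof -
  have "cis a * cnj (cis a) = 1" "cnj (cis a) * cis a = 1" for a
    by (simp_all add: cis_cnj cis_mult)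
  then have "rotation_mat \<theta> * adjoint_mat (rotation_mat \<theta>) = 1\<^sub>m 2"
    "adjoint_mat (rotation_mat \<theta>) * rotation_mat \<theta> = 1\<^sub>m 2"
    by (auto intro!: eq_matI simp: rotation_mat_def adjoint_mat_def scalar_prod_def sum_lessThan_2
        lessThan_atLeast0[symmetric] less_2_cases_iff)
  then show ?thesis by (simp add: unitary_mat_def rotation_mat_def)
qed

lemma wf_rotation_qa: "wf_qa (rotation_qa \<theta>)"
proof -
  have U: "unitary_mat 2 (qU (rotation_qa \<theta>) \<sigma>)" for \<sigma>
    using unitary_rotation_mat[of \<theta>] unitary_one_mat[of 2] by (simp add: rotation_qa_def)
  have "unit_vec (vec 2 (\<lambda>i. if i = 0 then inv_sqrt2 else - inv_sqrt2))"
    by (simp add: unit_vec_def cscalar_prod_eq_sum[of _ 2] sum_lessThan_2 inv_sqrt2_mult_cnj)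
  moreover have "is_subspace 2 {v \<in> carrier_vec 2. v $ 0 = v $ 1}"
    by (auto simp: is_subspace_def)
  ultimately show ?thesis
    using U unfolding wf_qa_def by (simp add: rotation_qa_def)
qed

lemma run_rotation_qa:
  "run (rotation_qa \<theta>) w n =
     vec 2 (\<lambda>i. if i = 0 then inv_sqrt2 else - inv_sqrt2 * cis (2 * pi * \<theta> * count_zeros w n))"
proof (induction n)
  case 0
  then show ?case by (auto simp: rotation_qa_def)
next
  case (Suc n)
  have "cis (2 * pi * \<theta>) * cis (2 * pi * \<theta> * count_zeros w n) = cis (2 * pi * \<theta> * (count_zeros w n + 1))"
    by (simp add: cis_mult algebra_simps)
  with Suc show ?case
    by (auto intro!: eq_vecI simp: rotation_qa_def rotation_mat_def scalar_prod_def sum_lessThan_2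
        lessThan_atLeast0[symmetric] less_2_cases_iff)
qed

lemma overlap_rotation_qa:
  assumes "psi \<in> qF (rotation_qa \<theta>)" "unit_vec psi"
  shows "overlap psi (run (rotation_qa \<theta>) w n) = (1 - cos (2 * pi * \<theta> * count_zeros w n)) / 2"
proof -
  define a where "a = psi $ 0"
  define \<phi> where "\<phi> = 2 * pi * \<theta> * count_zeros w n"
  have psi: "psi \<in> carrier_vec 2" "psi $ 0 = a" "psi $ 1 = a"
    using assms(1) by (auto simp: rotation_qa_def a_def)
  then have "a * cnj a = 1 / 2"
    using assms(2) by (simp add: unit_vec_def cscalar_prod_eq_sum[of _ 2] sum_lessThan_2 field_simps)
  then have a: "(cmod a)\<^sup>2 = 1 / 2"
    by (metis complex_norm_square of_real_divide of_real_eq_iff of_real_numeral of_real_1)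
  have "run (rotation_qa \<theta>) w n \<bullet>c psi = inv_sqrt2 * cnj a * (1 - cis \<phi>)"
    using psi by (simp add: run_rotation_qa cscalar_prod_eq_sum[of _ 2] sum_lessThan_2 \<phi>_def algebra_simps)
  then have "overlap psi (run (rotation_qa \<theta>) w n) = (cmod inv_sqrt2)\<^sup>2 * (cmod a)\<^sup>2 * (cmod (1 - cis \<phi>))\<^sup>2"
    by (simp add: overlap_def norm_mult power_mult_distrib)
  also have "(cmod (1 - cis \<phi>))\<^sup>2 = 2 - 2 * cos \<phi>"
    by (simp add: cmod_power2 power2_diff)
  also have "(cmod inv_sqrt2)\<^sup>2 = 1 / 2"
    by (simp add: inv_sqrt2_def norm_divide power_divide)
  finally show ?thesis using a by (simp add: \<phi>_def)
qed

lemma count_zeros_const: "count_zeros (\<lambda>_. 0) n = n"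
  by (induction n) auto

lemma count_zeros_suffix_ones: "\<forall>j\<ge>m. w j = 1 \<Longrightarrow> m \<le> n \<Longrightarrow> count_zeros w n = count_zeros w m"
  by (induction n) (auto simp: le_Suc_eq)

lemma cos_2pi_frac: "cos (2 * pi * x) = cos (2 * pi * frac x)"
proof -
  have "2 * pi * x = 2 * pi * frac x + 2 * pi * of_int \<lfloor>x\<rfloor>"
    by (simp add: frac_def algebra_simps)
  then show ?thesis by (simp add: cos_add sin_int_2pin cos_int_2pin)
qed

text \<open>Kronecker's theorem is applied to the irrational (N + 1) \<theta>, so that the multiple it
  produces exceeds N.\<close>

lemma frequently_cos_close_to_minus_1:
  assumes \<theta>: "\<theta> \<notin> \<rat>" and e: "0 < e"
  shows "\<exists>\<^sub>F n in sequentially. cos (2 * pi * \<theta> * real n) < -1 + e"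
  unfolding frequently_sequentially
proof
  fix N
  obtain \<delta> where \<delta>: "0 < \<delta>" "\<And>y. dist y pi < \<delta> \<Longrightarrow> dist (cos y) (cos pi) < e"
    using isCont_cos[of pi] e unfolding continuous_at_eps_delta by blast
  have "real (Suc N) * \<theta> \<notin> \<rat>"
  proof
    assume "real (Suc N) * \<theta> \<in> \<rat>"
    then have "real (Suc N) * \<theta> / real (Suc N) \<in> \<rat>" by (intro Rats_divide) auto
    then show False using \<theta> by simp
  qed
  then obtain k where k: "0 < k" "\<bar>frac (real k * (real (Suc N) * \<theta>)) - 1 / 2\<bar> < \<delta> / (2 * pi)"
    using Kronecker_approx_1_explicit[of _ "1 / 2" "\<delta> / (2 * pi)"] \<delta>(1) by auto
  define x where "x = frac (real k * (real (Suc N) * \<theta>))"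
  have "2 * pi * x - pi = 2 * pi * (x - 1 / 2)"
    by (simp add: algebra_simps)
  then have "\<bar>2 * pi * x - pi\<bar> = 2 * pi * \<bar>x - 1 / 2\<bar>"
    by (simp add: abs_mult)
  also have "\<dots> < \<delta>"
    using k(2) by (simp add: x_def field_simps)
  finally have "cos (2 * pi * x) < -1 + e"
    using \<delta>(2)[of "2 * pi * x"] by (simp add: dist_real_def)
  moreover have "cos (2 * pi * \<theta> * real (k * Suc N)) = cos (2 * pi * x)"
    unfolding x_def by (subst cos_2pi_frac[symmetric]) (simp add: algebra_simps)
  moreover have "N \<le> k * Suc N"
    using k(1) mult_le_mono1[of 1 k "Suc N"] by simp
  ultimately show "\<exists>n\<ge>N. cos (2 * pi * \<theta> * real n) < -1 + e"
    by auto
qed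

lemma cos_2pi_irrational_mult_neq_minus_1:
  assumes "\<theta> \<notin> \<rat>"
  shows "cos (2 * pi * \<theta> * real n) \<noteq> -1"
proof
  assume "cos (2 * pi * \<theta> * real n) = -1"
  then obtain x :: int where "2 * pi * \<theta> * real n = (2 * real_of_int x + 1) * pi"
    unfolding cos_eq_minus1 by blast
  then have "pi * (2 * \<theta> * real n) = pi * (2 * x + 1)"
    by (simp add: algebra_simps)
  then have x: "2 * \<theta> * real n = 2 * x + 1"
    by simp
  show False
  proof (cases "n = 0")
    case True
    then have "2 * x + 1 = 0"
      using x by simp
    then show False by presburger
  next
    case False
    then have "\<theta> = (2 * x + 1) / (2 * real n)"
      using x by (simp add: field_simps)
    then show False using assms by simp
  qed
qed

lemma fND_rotation_qa_zeros:
  assumes "\<theta> \<notin> \<rat>"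
  shows "fND (rotation_qa \<theta>) (\<lambda>_. 0) = 1"
proof -
  have A: "wf_qa (rotation_qa \<theta>)" "is_word (qalph (rotation_qa \<theta>)) (\<lambda>_. 0)"
    by (rule wf_rotation_qa) (simp add: is_word_def rotation_qa_def)
  have psi: "vec 2 (\<lambda>_. inv_sqrt2) \<in> qF (rotation_qa \<theta>)" "unit_vec (vec 2 (\<lambda>_. inv_sqrt2))"
    by (auto simp: rotation_qa_def unit_vec_def cscalar_prod_eq_sum[of _ 2] sum_lessThan_2 inv_sqrt2_mult_cnj)
  have "1 \<le> fND (rotation_qa \<theta>) (\<lambda>_. 0)"
  proof (rule le_fND_if_frequently[OF A psi])
    fix e :: real assume "0 < e"
    then have "\<exists>\<^sub>F n in sequentially. cos (2 * pi * \<theta> * real n) < -1 + 2 * e"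
      by (intro frequently_cos_close_to_minus_1 assms) simp
    then show "\<exists>\<^sub>F n in sequentially. 1 - e < overlap (vec 2 (\<lambda>_. inv_sqrt2)) (run (rotation_qa \<theta>) (\<lambda>_. 0) n)"
      by (rule frequently_elim1) (simp add: overlap_rotation_qa[OF psi] count_zeros_const)
  qed
  then show ?thesis using fND_le_1[OF A] by simp
qed

lemma fND_rotation_qa_suffix_ones:
  assumes "\<theta> \<notin> \<rat>" and suffix: "\<forall>j\<ge>m. w j = 1"
  shows "fND (rotation_qa \<theta>) w < 1"
proof -
  define c where "c = (1 - cos (2 * pi * \<theta> * count_zeros w m)) / 2"
  have "-1 < cos (2 * pi * \<theta> * count_zeros w m)"
    using cos_2pi_irrational_mult_neq_minus_1[OF assms(1), of "count_zeros w m"]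
      cos_ge_minus_one[of "2 * pi * \<theta> * count_zeros w m"] by linarith
  then have "c < 1" by (simp add: c_def)
  have "fND (rotation_qa \<theta>) w \<le> c"
  proof (rule fND_leI)
    fix psi and r :: "nat \<Rightarrow> nat"
    assume psi: "psi \<in> qF (rotation_qa \<theta>)" "unit_vec psi" and r: "strict_mono r"
    have "Inf (range (\<lambda>i. overlap psi (run (rotation_qa \<theta>) w (r i)))) \<le> overlap psi (run (rotation_qa \<theta>) w (r m))"
      by (rule Inf_overlap_le)
    also have "\<dots> = c"
      using count_zeros_suffix_ones[OF suffix seq_suble[OF r, of m]]
      by (simp add: overlap_rotation_qa[OF psi] c_def)
    finally show "Inf (range (\<lambda>i. overlap psi (run (rotation_qa \<theta>) w (r i)))) \<le> c" .
  qed (simp add: c_def)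
  with \<open>c < 1\<close> show ?thesis by simp
qed

lemma run_eq_on_prefix: "(\<And>j. j < m \<Longrightarrow> w j = v j) \<Longrightarrow> n \<le> m \<Longrightarrow> run A w n = run A v n"
  by (induction n) auto

lemma QBA_class_eq_1_not_subset_gt:
  assumes "0 \<le> l"
  shows "\<not> QBA_class (\<lambda>x. x = 1) \<subseteq> QBA_class (\<lambda>x. x > l)"
proof
  assume sub: "QBA_class (\<lambda>x. x = 1) \<subseteq> QBA_class (\<lambda>x. x > l)"
  obtain \<theta> :: real where \<theta>: "\<theta> \<notin> \<rat>"
    using countable_rat uncountable_UNIV_real by (metis countable_subset subsetI)
  define A where "A = rotation_qa \<theta>"
  have "lang (\<lambda>x. x = 1) A \<in> QBA_class (\<lambda>x. x > l)"
    using sub wf_rotation_qa unfolding QBA_class_def A_def by blast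
  then obtain B where B: "wf_qa B" and eq: "lang (\<lambda>x. x > l) B = lang (\<lambda>x. x = 1) A"
    unfolding QBA_class_def by auto
  have alph: "qalph B = {0, 1}"
    using arg_cong[OF eq, of fst] by (simp add: lang_def A_def rotation_qa_def)
  have acc: "l < fND B w \<longleftrightarrow> fND A w = 1" if "is_word {0, 1} w" for w
    using arg_cong[OF eq, of snd] that by (auto simp: lang_def A_def rotation_qa_def alph)
  have zeros: "is_word (qalph B) (\<lambda>_. 0)"
    by (simp add: alph is_word_def)
  have "l < fND B (\<lambda>_. 0)"
    using acc[of "\<lambda>_. 0"] fND_rotation_qa_zeros[OF \<theta>] zeros alph unfolding A_def by simp
  then obtain psi and r :: "nat \<Rightarrow> nat" where psi: "psi \<in> qF B" "unit_vec psi"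
    and "l < Inf (range (\<lambda>i. overlap psi (run B (\<lambda>_. 0) (r i))))"
    by (rule fND_gtE[OF B zeros _ assms])
  then have above: "l < overlap psi (run B (\<lambda>_. 0) (r 0))"
    using Inf_overlap_le[of psi "\<lambda>i. run B (\<lambda>_. 0) (r i)" 0] by linarith
  define w where "w j = (if j < r 0 then 0 else 1 :: nat)" for j
  have w: "is_word (qalph B) w"
    by (simp add: alph is_word_def w_def)
  have "run B w (r 0) = run B (\<lambda>_. 0) (r 0)"
    by (rule run_eq_on_prefix[where m = "r 0"]) (simp_all add: w_def)
  then have "l < fND B w"
    using above overlap_le_fND_const_suffix[OF B w _ psi, of "r 0" 1] by (simp add: w_def)
  moreover have "fND A w < 1"
    unfolding A_def by (rule fND_rotation_qa_suffix_ones[OF \<theta>, of "r 0"]) (simp add: w_def)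
  moreover have "is_word {0, 1} w"
    using w alph by simp
  ultimately show False
    using acc by fastforce
qed

section \<open>Padding an automaton by one dimension\<close>

definition pad_vec :: "nat \<Rightarrow> complex \<Rightarrow> complex \<Rightarrow> complex vec \<Rightarrow> complex vec" where
  "pad_vec d a b v = vec (Suc d) (\<lambda>i. if i < d then a * v $ i else b)"

definition pad_mat :: "nat \<Rightarrow> complex mat \<Rightarrow> complex mat" where
  "pad_mat d U = mat (Suc d) (Suc d) (\<lambda>(i, j). if i < d \<and> j < d then U $$ (i, j) else if i = j then 1 else 0)"

lemma pad_vec_carrier [simp]: "pad_vec d a b v \<in> carrier_vec (Suc d)"
  by (simp add: pad_vec_def)

lemma pad_vec_last [simp]: "pad_vec d a b v $ d = b"
  by (simp add: pad_vec_def)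

lemma vec_first_pad_vec: "v \<in> carrier_vec d \<Longrightarrow> vec_first (pad_vec d a b v) d = a \<cdot>\<^sub>v v"
  by (auto simp: pad_vec_def vec_first_def)

lemma cscalar_prod_Suc_split:
  "x \<in> carrier_vec (Suc d) \<Longrightarrow> y \<in> carrier_vec (Suc d) \<Longrightarrow>
   x \<bullet>c y = vec_first x d \<bullet>c vec_first y d + x $ d * cnj (y $ d)"
  by (simp add: cscalar_prod_eq_sum[of _ "Suc d"] cscalar_prod_eq_sum[of _ d] vec_first_def)

lemma cscalar_prod_smult_right:
  "y \<in> carrier_vec d \<Longrightarrow> x \<bullet>c (c \<cdot>\<^sub>v y) = cnj c * (x \<bullet>c y)"
  by (simp add: cscalar_prod_eq_sum[of _ d] sum_distrib_left mult_ac)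

lemma unit_vec_normalize:
  assumes "u \<in> carrier_vec d" "0 < (\<Sum>i<d. (cmod (u $ i))\<^sup>2)"
  shows "unit_vec (of_real (1 / sqrt (\<Sum>i<d. (cmod (u $ i))\<^sup>2)) \<cdot>\<^sub>v u)"
proof -
  define \<nu> where "\<nu> = (\<Sum>i<d. (cmod (u $ i))\<^sup>2)"
  have "(of_real (1 / sqrt \<nu>) \<cdot>\<^sub>v u) \<bullet>c (of_real (1 / sqrt \<nu>) \<cdot>\<^sub>v u) =
      of_real (1 / sqrt \<nu>) * of_real (1 / sqrt \<nu>) * (u \<bullet>c u)"
    using assms(1) by (simp add: cscalar_prod_smult_right)
  also have "\<dots> = 1"
    using cscalar_prod_self_eq_sum[OF assms(1)] assms(2) by (simp add: \<nu>_def[symmetric] flip: of_real_mult)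
  finally show ?thesis
    by (simp add: unit_vec_def \<nu>_def)
qed

lemma pad_vec_cscalar_prod:
  assumes "s \<in> carrier_vec d" "psi \<in> carrier_vec (Suc d)"
  shows "pad_vec d a b s \<bullet>c psi = a * (s \<bullet>c vec_first psi d) + b * cnj (psi $ d)"
  using assms by (simp add: cscalar_prod_Suc_split[of _ d] vec_first_pad_vec)

lemma unit_vec_pad_vec:
  assumes "v \<in> carrier_vec d" "unit_vec v" "a * cnj a + b * cnj b = 1"
  shows "unit_vec (pad_vec d a b v)"
  using assms unfolding unit_vec_def
  by (simp add: pad_vec_cscalar_prod vec_first_pad_vec cscalar_prod_smult_right mult_ac)

lemma pad_mat_carrier [simp]: "pad_mat d U \<in> carrier_mat (Suc d) (Suc d)"
  by (simp add: pad_mat_def)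

lemma dim_pad_mat [simp]: "dim_row (pad_mat d U) = Suc d" "dim_col (pad_mat d U) = Suc d"
  by (simp_all add: pad_mat_def)

lemma adjoint_pad_mat: "U \<in> carrier_mat d d \<Longrightarrow> adjoint_mat (pad_mat d U) = pad_mat d (adjoint_mat U)"
  by (auto intro!: eq_matI simp: pad_mat_def adjoint_mat_def)

lemma pad_mat_mult:
  assumes "U \<in> carrier_mat d d" "V \<in> carrier_mat d d"
  shows "pad_mat d U * pad_mat d V = pad_mat d (U * V)"
proof (rule eq_matI)
  fix i j assume "i < dim_row (pad_mat d (U * V))" "j < dim_col (pad_mat d (U * V))"
  then have ij: "i < Suc d" "j < Suc d" by (auto simp: pad_mat_def)
  have "(pad_mat d U * pad_mat d V) $$ (i, j) =
      (\<Sum>l<d. pad_mat d U $$ (i, l) * pad_mat d V $$ (l, j)) + pad_mat d U $$ (i, d) * pad_mat d V $$ (d, j)"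
    using ij by (simp add: mult_mat_index_sum[of _ "Suc d" "Suc d" _ "Suc d"] del: index_mult_mat)
  also have "\<dots> = pad_mat d (U * V) $$ (i, j)"
  proof (cases "i < d \<and> j < d")
    case True
    then show ?thesis
      using assms ij by (simp add: pad_mat_def mult_mat_index_sum del: index_mult_mat)
  next
    case False
    then show ?thesis
      using assms ij by (auto simp: pad_mat_def if_distrib cong: if_cong)
  qed
  finally show "(pad_mat d U * pad_mat d V) $$ (i, j) = pad_mat d (U * V) $$ (i, j)" .
qed (auto simp: pad_mat_def)

lemma unitary_pad_mat: "unitary_mat d U \<Longrightarrow> unitary_mat (Suc d) (pad_mat d U)"
proof -
  assume U: "unitary_mat d U"
  then have Uc: "U \<in> carrier_mat d d" and Ua: "adjoint_mat U \<in> carrier_mat d d"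
    by (auto simp: unitary_mat_def adjoint_mat_def)
  have "pad_mat d (1\<^sub>m d) = 1\<^sub>m (Suc d)"
    by (auto intro!: eq_matI simp: pad_mat_def)
  with U show ?thesis unfolding unitary_mat_def
    by (simp add: adjoint_pad_mat[OF Uc] pad_mat_mult[OF Uc Ua] pad_mat_mult[OF Ua Uc])
qed

lemma pad_mat_mult_pad_vec:
  assumes U: "U \<in> carrier_mat d d" and v: "v \<in> carrier_vec d"
  shows "pad_mat d U *\<^sub>v pad_vec d a b v = pad_vec d a b (U *\<^sub>v v)"
proof (rule eq_vecI)
  fix i assume "i < dim_vec (pad_vec d a b (U *\<^sub>v v))"
  then have i: "i < Suc d" by (simp add: pad_vec_def)
  have "(pad_mat d U *\<^sub>v pad_vec d a b v) $ i =
      (\<Sum>j<d. pad_mat d U $$ (i, j) * pad_vec d a b v $ j) + pad_mat d U $$ (i, d) * b"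
    using i by (simp add: mult_mat_vec_index_sum[of _ "Suc d" "Suc d"] del: index_mult_mat_vec)
  also have "\<dots> = pad_vec d a b (U *\<^sub>v v) $ i"
    using U v i
    by (cases "i < d") (simp_all add: pad_mat_def pad_vec_def mult_mat_vec_index_sum sum_distrib_left
        mult_ac del: index_mult_mat_vec)
  finally show "(pad_mat d U *\<^sub>v pad_vec d a b v) $ i = pad_vec d a b (U *\<^sub>v v) $ i" .
qed (simp add: pad_vec_def)

definition pad_qa :: "qa \<Rightarrow> real \<Rightarrow> bool \<Rightarrow> qa" where
  "pad_qa A p accept_e = \<lparr>qdim = Suc (qdim A),
     qinit = pad_vec (qdim A) (of_real (sqrt p)) (of_real (sqrt (1 - p))) (qinit A),
     qalph = qalph A, qU = (\<lambda>\<sigma>. pad_mat (qdim A) (qU A \<sigma>)),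
     qF = {v \<in> carrier_vec (Suc (qdim A)). vec_first v (qdim A) \<in> qF A \<and> (accept_e \<or> v $ qdim A = 0)}\<rparr>"

lemma pad_qa_simps [simp]:
  "qdim (pad_qa A p e) = Suc (qdim A)"
  "qinit (pad_qa A p e) = pad_vec (qdim A) (of_real (sqrt p)) (of_real (sqrt (1 - p))) (qinit A)"
  "qalph (pad_qa A p e) = qalph A"
  "qU (pad_qa A p e) = (\<lambda>\<sigma>. pad_mat (qdim A) (qU A \<sigma>))"
  "qF (pad_qa A p e) = {v \<in> carrier_vec (Suc (qdim A)). vec_first v (qdim A) \<in> qF A \<and> (e \<or> v $ qdim A = 0)}"
  by (simp_all add: pad_qa_def)

lemma wf_pad_qa:
  assumes A: "wf_qa A" and p: "0 \<le> p" "p \<le> 1"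
  shows "wf_qa (pad_qa A p e)"
proof -
  define d where "d = qdim A"
  have F: "is_subspace d (qF A)" and s: "qinit A \<in> carrier_vec d" "unit_vec (qinit A)"
    using A by (simp_all add: wf_qa_def d_def)
  have unit: "unit_vec (qinit (pad_qa A p e))"
    using s p by (simp add: d_def[symmetric] unit_vec_pad_vec flip: of_real_mult)
  have first_zero: "vec_first (0\<^sub>v (Suc d)) d = 0\<^sub>v d"
    by (auto simp: vec_first_def)
  have first: "vec_first (u + v) d = vec_first u d + vec_first v d"
    "vec_first (c \<cdot>\<^sub>v u) d = c \<cdot>\<^sub>v vec_first u d"
    if "u \<in> carrier_vec (Suc d)" "v \<in> carrier_vec (Suc d)" for u v c
    using that by (auto simp: vec_first_def)
  have "is_subspace (Suc d) (qF (pad_qa A p e))"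
    using F unfolding is_subspace_def by (auto simp: d_def[symmetric] first_zero first)
  moreover have "unitary_mat (Suc d) (pad_mat d (qU A \<sigma>))" if "\<sigma> \<in> qalph A" for \<sigma>
    using A that by (simp add: unitary_pad_mat qU_unitary d_def)
  ultimately show ?thesis
    using A unit by (simp add: wf_qa_def d_def)
qed

lemma run_pad_qa:
  assumes "wf_qa A" "is_word (qalph A) w"
  shows "run (pad_qa A p e) w n = pad_vec (qdim A) (of_real (sqrt p)) (of_real (sqrt (1 - p))) (run A w n)"
proof (induction n)
  case (Suc n)
  have "qU A (w n) \<in> carrier_mat (qdim A) (qdim A)"
    using assms by (simp add: qU_unitary is_word_def unitary_mat_carrier)
  then show ?case
    using Suc pad_mat_mult_pad_vec run_carrier_unit[OF assms] by simp
qed simp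

lemma overlap_run_pad_qa:
  assumes "wf_qa A" "is_word (qalph A) w" "psi \<in> carrier_vec (Suc (qdim A))"
  shows "overlap psi (run (pad_qa A p e) w n) =
    (cmod (of_real (sqrt p) * (run A w n \<bullet>c vec_first psi (qdim A)) + of_real (sqrt (1 - p)) * cnj (psi $ qdim A)))\<^sup>2"
  using assms run_carrier_unit[OF assms(1,2)] by (simp add: overlap_def run_pad_qa pad_vec_cscalar_prod)

lemma overlap_run_pad_qa_pad_vec:
  assumes "wf_qa A" "is_word (qalph A) w" "phi \<in> carrier_vec (qdim A)"
  shows "overlap (pad_vec (qdim A) c b phi) (run (pad_qa A p e) w n) =
    (cmod (of_real (sqrt p) * cnj c * (run A w n \<bullet>c phi) + of_real (sqrt (1 - p)) * cnj b))\<^sup>2"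
  using assms by (simp add: overlap_run_pad_qa vec_first_pad_vec cscalar_prod_smult_right mult_ac)

lemma pad_vec_mem_qF_pad_qa:
  assumes "wf_qa A" "phi \<in> qF A" "e \<or> b = 0"
  shows "pad_vec (qdim A) c b phi \<in> qF (pad_qa A p e)"
proof -
  have "c \<cdot>\<^sub>v phi \<in> qF A"
    using assms(1,2) by (simp add: wf_qa_def is_subspace_def)
  then show ?thesis
    using assms qF_carrier[OF assms(1,2)] by (simp add: vec_first_pad_vec)
qed

lemma Inf_le_affine_Inf:
  fixes f g :: "nat \<Rightarrow> real"
  assumes "0 < p" "\<And>i. 0 \<le> f i" "\<And>i. 0 \<le> g i" "\<And>i. f i \<le> p * g i + q"
  shows "Inf (range f) \<le> p * Inf (range g) + q"
proof -
  have "(Inf (range f) - q) / p \<le> g i" for i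
  proof -
    have "Inf (range f) \<le> f i"
      by (rule cINF_lower) (auto intro: bdd_belowI2 assms(2))
    then show ?thesis using assms(1) assms(4)[of i] by (simp add: field_simps)
  qed
  then have "(Inf (range f) - q) / p \<le> Inf (range g)"
    by (intro cINF_greatest) auto
  then show ?thesis using assms(1) by (simp add: field_simps)
qed

lemma overlap_run_pad_qa_scaled:
  assumes A: "wf_qa A" and w: "is_word (qalph A) w" and p: "0 \<le> p"
    and psi: "psi \<in> qF (pad_qa A p False)" "unit_vec psi"
  shows "vec_first psi (qdim A) \<in> qF A" "unit_vec (vec_first psi (qdim A))"
    and "overlap psi (run (pad_qa A p False) w n) = p * overlap (vec_first psi (qdim A)) (run A w n)"
proof -
  have psic: "psi \<in> carrier_vec (Suc (qdim A))" "psi $ qdim A = 0"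
    using psi(1) by simp_all
  show "vec_first psi (qdim A) \<in> qF A"
    using psi(1) by simp
  show "unit_vec (vec_first psi (qdim A))"
    using psi(2) cscalar_prod_Suc_split[OF psic(1) psic(1)] by (simp add: unit_vec_def psic(2))
  show "overlap psi (run (pad_qa A p False) w n) = p * overlap (vec_first psi (qdim A)) (run A w n)"
    using overlap_run_pad_qa[OF A w psic(1)] psic(2) p by (simp add: overlap_def norm_mult power_mult_distrib)
qed

lemma fND_pad_qa_scaled:
  assumes A: "wf_qa A" and w: "is_word (qalph A) w" and p: "0 < p" "p \<le> 1"
  shows "fND (pad_qa A p False) w = p * fND A w"
proof (rule antisym)
  define B where "B = pad_qa A p False"
  have B: "wf_qa B" "is_word (qalph B) w"
    using wf_pad_qa[OF A] p w by (auto simp: B_def)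
  show "fND B w \<le> p * fND A w"
  proof (rule fND_leI)
    fix psi and r :: "nat \<Rightarrow> nat" assume psi: "psi \<in> qF B" "unit_vec psi" "strict_mono r"
    note u = overlap_run_pad_qa_scaled[OF A w less_imp_le[OF p(1)] psi(1,2)[unfolded B_def]]
    have "Inf (range (\<lambda>i. overlap psi (run B w (r i)))) \<le>
        p * Inf (range (\<lambda>i. overlap (vec_first psi (qdim A)) (run A w (r i)))) + 0"
      using p(1) by (intro Inf_le_affine_Inf) (simp_all add: B_def u(3) overlap_nonneg)
    also have "\<dots> \<le> p * fND A w"
      using Inf_overlap_le_fND[OF A w u(1,2) psi(3)] p(1) by simp
    finally show "Inf (range (\<lambda>i. overlap psi (run B w (r i)))) \<le> p * fND A w" .
  qed (use fND_nonneg[OF A w] p in simp)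
  have "fND A w \<le> fND B w / p"
  proof (rule fND_leI)
    fix phi and r :: "nat \<Rightarrow> nat" assume phi: "phi \<in> qF A" "unit_vec phi" "strict_mono r"
    define psi where "psi = pad_vec (qdim A) 1 0 phi"
    have phic: "phi \<in> carrier_vec (qdim A)"
      using qF_carrier[OF A phi(1)] .
    have psi: "psi \<in> qF B" "unit_vec psi"
      using pad_vec_mem_qF_pad_qa[OF A phi(1)] unit_vec_pad_vec[OF phic phi(2)]
      by (simp_all add: psi_def B_def)
    have ov: "overlap psi (run B w n) = p * overlap phi (run A w n)" for n
      using overlap_run_pad_qa_pad_vec[OF A w phic] p
      by (simp add: psi_def B_def overlap_def norm_mult power_mult_distrib)
    have "p * Inf (range (\<lambda>i. overlap phi (run A w (r i)))) \<le> Inf (range (\<lambda>i. overlap psi (run B w (r i))))"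
      using p(1) by (intro cINF_greatest) (auto simp: ov intro: mult_left_mono Inf_overlap_le)
    also have "\<dots> \<le> fND B w"
      by (rule Inf_overlap_le_fND[OF B psi phi(3)])
    finally show "Inf (range (\<lambda>i. overlap phi (run A w (r i)))) \<le> fND B w / p"
      using p(1) by (simp add: field_simps)
  qed (use fND_nonneg[OF B] p in simp)
  then show "p * fND A w \<le> fND B w"
    using p(1) by (simp add: field_simps)
qed

lemma norm_mult_add_mult_power2_le:
  fixes a b x y :: complex
  shows "(cmod (a * x + b * y))\<^sup>2 \<le> ((cmod a)\<^sup>2 + (cmod b)\<^sup>2) * ((cmod x)\<^sup>2 + (cmod y)\<^sup>2)"
proof -
  have "cmod (a * x + b * y) \<le> cmod a * cmod x + cmod b * cmod y"
    by (metis norm_mult norm_triangle_ineq)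
  then have "(cmod (a * x + b * y))\<^sup>2 \<le> (cmod a * cmod x + cmod b * cmod y)\<^sup>2"
    by (intro power_mono) auto
  also have "\<dots> \<le> ((cmod a)\<^sup>2 + (cmod b)\<^sup>2) * ((cmod x)\<^sup>2 + (cmod y)\<^sup>2)"
    using sum_squares_ge_zero[of "cmod a * cmod y - cmod b * cmod x" 0]
    by (simp add: power2_eq_square algebra_simps)
  finally show ?thesis .
qed

text \<open>Writing the old part of psi as sqrt \<nu> phi with phi a unit vector, Cauchy-Schwarz in two
  dimensions bounds the overlap by p times that of phi plus 1 - p.\<close>

lemma overlap_run_pad_qa_shifted_cases:
  assumes A: "wf_qa A" and w: "is_word (qalph A) w" and p: "0 \<le> p" "p \<le> 1"
    and psi: "psi \<in> qF (pad_qa A p True)" "unit_vec psi"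
  obtains "\<And>n. overlap psi (run (pad_qa A p True) w n) = 1 - p"
  | phi where "phi \<in> qF A" "unit_vec phi"
      "\<And>n. overlap psi (run (pad_qa A p True) w n) \<le> p * overlap phi (run A w n) + (1 - p)"
proof -
  define d where "d = qdim A"
  define u where "u = vec_first psi d"
  define \<beta> where "\<beta> = psi $ d"
  define \<nu> where "\<nu> = (\<Sum>i<d. (cmod (u $ i))\<^sup>2)"
  have psic: "psi \<in> carrier_vec (Suc d)" and u: "u \<in> carrier_vec d" "u \<in> qF A"
    using psi(1) by (simp_all add: d_def u_def)
  have norm1: "\<nu> + (cmod \<beta>)\<^sup>2 = 1"
    using unit_vec_sum_norm[OF psic psi(2)] by (simp add: \<nu>_def u_def \<beta>_def vec_first_def)
  have \<nu>: "0 \<le> \<nu>"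
    by (simp add: \<nu>_def sum_nonneg)
  have ov: "overlap psi (run (pad_qa A p True) w n) =
      (cmod (of_real (sqrt p) * (run A w n \<bullet>c u) + of_real (sqrt (1 - p)) * cnj \<beta>))\<^sup>2" for n
    using overlap_run_pad_qa[OF A w psic[unfolded d_def]] by (simp add: u_def \<beta>_def d_def)
  show thesis
  proof (cases "\<nu> = 0")
    case True
    then have "u $ i = 0" if "i < d" for i
      using that sum_nonneg_eq_0_iff[of "{..<d}" "\<lambda>i. (cmod (u $ i))\<^sup>2"] by (simp add: \<nu>_def)
    then have "run A w n \<bullet>c u = 0" for n
      using u(1) by (simp add: cscalar_prod_eq_sum)
    then show thesis
      using that(1) ov norm1 True p by (simp add: norm_mult power_mult_distrib)
  next
    case False
    define phi where "phi = of_real (1 / sqrt \<nu>) \<cdot>\<^sub>v u"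
    have phi: "phi \<in> carrier_vec d" "phi \<in> qF A"
      using A u unfolding phi_def d_def wf_qa_def is_subspace_def by auto
    have "unit_vec phi"
      using unit_vec_normalize[OF u(1)] False \<nu> by (simp add: phi_def \<nu>_def)
    have u_phi: "run A w n \<bullet>c u = of_real (sqrt \<nu>) * (run A w n \<bullet>c phi)" for n
      using u(1) False \<nu> by (simp add: phi_def cscalar_prod_smult_right)
    have "overlap psi (run (pad_qa A p True) w n) \<le> p * overlap phi (run A w n) + (1 - p)" for n
    proof -
      have "overlap psi (run (pad_qa A p True) w n) =
          (cmod (of_real (sqrt \<nu>) * (of_real (sqrt p) * (run A w n \<bullet>c phi)) + cnj \<beta> * of_real (sqrt (1 - p))))\<^sup>2"
        by (simp add: ov u_phi mult_ac)
      also have "\<dots> \<le> ((cmod (of_real (sqrt \<nu>)))\<^sup>2 + (cmod (cnj \<beta>))\<^sup>2) *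
          ((cmod (of_real (sqrt p) * (run A w n \<bullet>c phi)))\<^sup>2 + (cmod (complex_of_real (sqrt (1 - p))))\<^sup>2)"
        by (rule norm_mult_add_mult_power2_le)
      also have "\<dots> = p * overlap phi (run A w n) + (1 - p)"
        using norm1 \<nu> p by (simp add: overlap_def norm_mult power_mult_distrib)
      finally show ?thesis .
    qed
    then show thesis
      using that(2) phi(2) \<open>unit_vec phi\<close> by blast
  qed
qed

lemma fND_pad_qa_shifted_le:
  assumes A: "wf_qa A" and w: "is_word (qalph A) w" and p: "0 < p" "p < 1"
  shows "fND (pad_qa A p True) w \<le> p * fND A w + (1 - p)"
proof (rule fND_leI)
  fix psi and r :: "nat \<Rightarrow> nat"
  assume psi: "psi \<in> qF (pad_qa A p True)" "unit_vec psi" and r: "strict_mono r"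
  let ?Inf = "Inf (range (\<lambda>i. overlap psi (run (pad_qa A p True) w (r i))))"
  have "0 \<le> fND A w"
    using fND_nonneg[OF A w] .
  from overlap_run_pad_qa_shifted_cases[OF A w less_imp_le[OF p(1)] less_imp_le[OF p(2)] psi]
  show "?Inf \<le> p * fND A w + (1 - p)"
  proof cases
    case 1
    then have "?Inf \<le> 1 - p"
      using Inf_overlap_le[of psi "\<lambda>i. run (pad_qa A p True) w (r i)" 0] by simp
    with \<open>0 \<le> fND A w\<close> p show ?thesis
      by (smt (verit) mult_nonneg_nonneg)
  next
    case (2 phi)
    then have "?Inf \<le> p * Inf (range (\<lambda>i. overlap phi (run A w (r i)))) + (1 - p)"
      using p(1) by (intro Inf_le_affine_Inf) (simp_all add: overlap_nonneg)
    also have "\<dots> \<le> p * fND A w + (1 - p)"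
      using Inf_overlap_le_fND[OF A w 2(1,2) r] p by simp
    finally show ?thesis .
  qed
qed (use fND_nonneg[OF A w] p in simp)

lemma unit_vec_pad_vec_aligned:
  fixes z :: complex
  assumes "phi \<in> carrier_vec d" "unit_vec phi" "0 \<le> p" "p \<le> 1"
    and N: "N = p * (cmod z)\<^sup>2 + (1 - p)" "0 < N"
  shows "unit_vec (pad_vec d (of_real (sqrt p / sqrt N) * z) (of_real (sqrt (1 - p) / sqrt N)) phi)"
proof (rule unit_vec_pad_vec[OF assms(1,2)])
  let ?c = "of_real (sqrt p / sqrt N) * z" and ?b = "complex_of_real (sqrt (1 - p) / sqrt N)"
  have "?c * cnj ?c + ?b * cnj ?b = of_real (p / N) * (z * cnj z) + of_real ((1 - p) / N)"
    using assms by (simp add: mult_ac real_sqrt_divide flip: of_real_mult)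
  also have "\<dots> = of_real (p / N * (cmod z)\<^sup>2 + (1 - p) / N)"
    by (simp flip: complex_norm_square)
  also have "p / N * (cmod z)\<^sup>2 + (1 - p) / N = 1"
    using N by (simp flip: add_divide_distrib)
  finally show "?c * cnj ?c + ?b * cnj ?b = 1"
    by simp
qed

lemma overlap_run_pad_qa_aligned:
  fixes z :: complex
  assumes A: "wf_qa A" "is_word (qalph A) w" and phi: "phi \<in> carrier_vec (qdim A)"
    and p: "0 \<le> p" "p \<le> 1" and N: "0 < N"
  shows "overlap (pad_vec (qdim A) (of_real (sqrt p / sqrt N) * z) (of_real (sqrt (1 - p) / sqrt N)) phi)
      (run (pad_qa A p e) w n) = (cmod (of_real p * cnj z * (run A w n \<bullet>c phi) + of_real (1 - p)))\<^sup>2 / N"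
proof -
  have "of_real (sqrt p) * cnj (of_real (sqrt p / sqrt N) * z) * (run A w n \<bullet>c phi)
        + of_real (sqrt (1 - p)) * cnj (of_real (sqrt (1 - p) / sqrt N)) =
      (of_real p * cnj z * (run A w n \<bullet>c phi) + of_real (1 - p)) / of_real (sqrt N)"
    using p N by (simp add: field_simps flip: of_real_mult)
  then show ?thesis
    using overlap_run_pad_qa_pad_vec[OF A phi] N by (simp add: norm_divide power_divide)
qed

text \<open>The witness psi is aligned with a limit point z of the overlaps along r, so that its overlap
  with the padded run tends to p |z|^2 + 1 - p along a further subsequence.\<close>

lemma le_fND_pad_qa_shifted:
  fixes r :: "nat \<Rightarrow> nat"
  assumes A: "wf_qa A" and w: "is_word (qalph A) w" and p: "0 < p" "p < 1"
    and phi: "phi \<in> qF A" "unit_vec phi" and r: "strict_mono r"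
  shows "p * Inf (range (\<lambda>i. overlap phi (run A w (r i)))) + (1 - p) \<le> fND (pad_qa A p True) w"
proof -
  define B where "B = pad_qa A p True"
  have B: "wf_qa B" "is_word (qalph B) w"
    using wf_pad_qa[OF A] p w by (auto simp: B_def)
  have phic: "phi \<in> carrier_vec (qdim A)"
    using qF_carrier[OF A phi(1)] .
  define X where "X i = run A w (r i) \<bullet>c phi" for i
  have "bounded (range X)"
    using norm_cscalar_prod_unit_le_1[OF phic phi(2)] run_carrier_unit[OF A w]
    by (intro boundedI[of _ 1]) (auto simp: X_def)
  then obtain z h where h: "strict_mono h" "(X \<circ> h) \<longlonglongrightarrow> z"
    using bounded_imp_convergent_subsequence by blast
  have "Inf (range (\<lambda>i. overlap phi (run A w (r i)))) \<le> (cmod (X (h k)))\<^sup>2" for k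
    using Inf_overlap_le[of phi "\<lambda>i. run A w (r i)" "h k"] by (simp add: overlap_def X_def)
  moreover have "(\<lambda>k. (cmod (X (h k)))\<^sup>2) \<longlonglongrightarrow> (cmod z)\<^sup>2"
    using h(2) by (intro tendsto_intros) (simp add: o_def)
  ultimately have Inf_le: "Inf (range (\<lambda>i. overlap phi (run A w (r i)))) \<le> (cmod z)\<^sup>2"
    by (intro LIMSEQ_le_const) auto
  define N where "N = p * (cmod z)\<^sup>2 + (1 - p)"
  have N: "0 < N"
    using p by (simp add: N_def add_nonneg_pos)
  define psi where "psi = pad_vec (qdim A) (of_real (sqrt p / sqrt N) * z) (of_real (sqrt (1 - p) / sqrt N)) phi"
  have psi: "psi \<in> qF B" "unit_vec psi"
    using pad_vec_mem_qF_pad_qa[OF A phi(1), where e = True] unit_vec_pad_vec_aligned[OF phic phi(2) _ _ N_def N] p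
    by (simp_all add: psi_def B_def)
  define G where "G y = (cmod (of_real p * cnj z * y + of_real (1 - p)))\<^sup>2 / N" for y
  have "(\<lambda>k. G (X (h k))) \<longlonglongrightarrow> G z"
    unfolding G_def using h(2) N by (intro tendsto_intros) (simp_all add: o_def)
  moreover have "G z = N"
  proof -
    have "cnj z * z = of_real ((cmod z)\<^sup>2)"
      by (metis complex_norm_square mult.commute)
    then have "of_real p * cnj z * z + of_real (1 - p) = complex_of_real N"
      by (simp add: N_def mult.assoc)
    then show ?thesis
      using N by (simp add: G_def power2_eq_square)
  qed
  ultimately have lim: "(\<lambda>k. overlap psi (run B w (r (h k)))) \<longlonglongrightarrow> N"
    using overlap_run_pad_qa_aligned[OF A w phic _ _ N] p by (simp add: psi_def B_def G_def X_def)
  have "N \<le> fND B w"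
  proof (rule le_fND_if_frequently[OF B psi])
    fix e :: real assume "0 < e"
    with lim have "\<forall>\<^sub>F k in sequentially. N - e < overlap psi (run B w (r (h k)))"
      by (auto dest!: tendstoD simp: dist_real_def elim!: eventually_mono)
    then show "\<exists>\<^sub>F n in sequentially. N - e < overlap psi (run B w n)"
      using frequently_of_strict_mono[OF strict_mono_o[OF r h(1)]] by (simp add: o_def)
  qed
  then show ?thesis
    using Inf_le p unfolding N_def B_def by (smt (verit) mult_left_mono)
qed

lemma fND_pad_qa_shifted:
  assumes A: "wf_qa A" and w: "is_word (qalph A) w" and p: "0 < p" "p < 1"
  shows "fND (pad_qa A p True) w = p * fND A w + (1 - p)"
proof (rule antisym[OF fND_pad_qa_shifted_le[OF assms]])
  define B where "B = pad_qa A p True"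
  have B: "wf_qa B" "is_word (qalph B) w"
    using wf_pad_qa[OF A] p w by (auto simp: B_def)
  define e where "e = pad_vec (qdim A) 0 1 (0\<^sub>v (qdim A))"
  have e: "e \<in> qF B" "unit_vec e"
    using pad_vec_mem_qF_pad_qa[OF A, of "0\<^sub>v (qdim A)"] A
    by (simp_all add: e_def B_def wf_qa_def is_subspace_def unit_vec_def pad_vec_cscalar_prod)
  have "overlap e (run B w n) = 1 - p" for n
    using overlap_run_pad_qa_pad_vec[OF A w] p by (simp add: e_def B_def overlap_def)
  then have "1 - p \<le> fND B w"
    by (intro le_fND_if_frequently[OF B e]) simp
  have "fND A w \<le> (fND B w - (1 - p)) / p"
  proof (rule fND_leI)
    fix phi and r :: "nat \<Rightarrow> nat" assume "phi \<in> qF A" "unit_vec phi" "strict_mono r"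
    then show "Inf (range (\<lambda>i. overlap phi (run A w (r i)))) \<le> (fND B w - (1 - p)) / p"
      using le_fND_pad_qa_shifted[OF A w p] p by (simp add: B_def field_simps)
  qed (use \<open>1 - p \<le> fND B w\<close> p in simp)
  then show "p * fND A w + (1 - p) \<le> fND B w"
    using p by (simp add: field_simps)
qed

section \<open>Moving thresholds\<close>

lemma QBA_class_subsetI:
  assumes "\<And>A. wf_qa A \<Longrightarrow> \<exists>B. wf_qa B \<and> qalph B = qalph A \<and>
      (\<forall>w. is_word (qalph A) w \<longrightarrow> (Q (fND B w) \<longleftrightarrow> P (fND A w)))"
  shows "QBA_class P \<subseteq> QBA_class Q"
proof
  fix L assume "L \<in> QBA_class P"
  then obtain A where A: "wf_qa A" and L: "L = lang P A"
    unfolding QBA_class_def by blast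
  obtain B where B: "wf_qa B" "qalph B = qalph A"
    and acc: "\<forall>w. is_word (qalph A) w \<longrightarrow> (Q (fND B w) \<longleftrightarrow> P (fND A w))"
    using assms[OF A] by blast
  have "L = lang Q B"
    unfolding L lang_def using B(2) acc by auto
  then show "L \<in> QBA_class Q"
    using B(1) unfolding QBA_class_def by blast
qed

lemma QBA_class_cong:
  assumes "\<And>x. 0 \<le> x \<Longrightarrow> x \<le> 1 \<Longrightarrow> P x \<longleftrightarrow> Q x"
  shows "QBA_class P = QBA_class Q"
proof -
  have eq: "lang P A = lang Q A" if "wf_qa A" for A
    using assms fND_nonneg[OF that] fND_le_1[OF that] by (auto simp: lang_def)
  show ?thesis
    unfolding QBA_class_def setcompr_eq_image by (rule image_cong) (simp_all add: eq)
qed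

lemma rescale_threshold:
  assumes A: "wf_qa A" and m: "0 \<le> m" "m \<le> 1" and l: "0 < l" "l < 1"
  shows "\<exists>B c. wf_qa B \<and> qalph B = qalph A \<and> 0 < c \<and>
    (\<forall>w. is_word (qalph A) w \<longrightarrow> fND B w - l = c * (fND A w - m))"
proof (cases "l \<le> m")
  case True
  define p where "p = l / m"
  have p: "0 < p" "p \<le> 1"
    using True m l by (auto simp: p_def)
  have "p * f - l = p * (f - m)" for f
    using True l by (simp add: p_def field_simps)
  then show ?thesis
    using wf_pad_qa[OF A] fND_pad_qa_scaled[OF A _ p] p
    by (intro exI[of _ "pad_qa A p False"] exI[of _ p]) auto
next
  case False
  define p where "p = (1 - l) / (1 - m)"
  have p: "0 < p" "p < 1"
    using False m l by (auto simp: p_def field_simps)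
  have "p * (1 - m) = 1 - l"
    using False l by (simp add: p_def)
  then have "p * f + (1 - p) - l = p * (f - m)" for f
    by (simp add: algebra_simps)
  then show ?thesis
    using wf_pad_qa[OF A] fND_pad_qa_shifted[OF A _ p] p
    by (intro exI[of _ "pad_qa A p True"] exI[of _ p]) auto
qed

lemma QBA_class_threshold_subset:
  assumes "0 \<le> m" "m \<le> 1" "0 < l" "l < 1"
  shows "QBA_class (\<lambda>x. x > m) \<subseteq> QBA_class (\<lambda>x. x > l)"
    and "QBA_class (\<lambda>x. x \<ge> m) \<subseteq> QBA_class (\<lambda>x. x \<ge> l)"
proof -
  have rescale: "\<exists>B. wf_qa B \<and> qalph B = qalph A \<and>
      (\<forall>w. is_word (qalph A) w \<longrightarrow> (l < fND B w \<longleftrightarrow> m < fND A w) \<and> (l \<le> fND B w \<longleftrightarrow> m \<le> fND A w))"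
    if A: "wf_qa A" for A
  proof -
    obtain B c where B: "wf_qa B" "qalph B = qalph A" "0 < c"
      and eq: "\<forall>w. is_word (qalph A) w \<longrightarrow> fND B w - l = c * (fND A w - m)"
      using rescale_threshold[OF A assms] by blast
    have "(l < fND B w \<longleftrightarrow> m < fND A w) \<and> (l \<le> fND B w \<longleftrightarrow> m \<le> fND A w)"
      if "is_word (qalph A) w" for w
    proof -
      have "0 < fND B w - l \<longleftrightarrow> 0 < fND A w - m" "0 \<le> fND B w - l \<longleftrightarrow> 0 \<le> fND A w - m"
        unfolding eq[rule_format, OF that] using \<open>0 < c\<close> by (simp_all add: zero_less_mult_iff zero_le_mult_iff)
      then show ?thesis by auto
    qed
    then show ?thesis using B by blast
  qed
  show "QBA_class (\<lambda>x. x > m) \<subseteq> QBA_class (\<lambda>x. x > l)"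
    by (rule QBA_class_subsetI) (use rescale in blast)
  show "QBA_class (\<lambda>x. x \<ge> m) \<subseteq> QBA_class (\<lambda>x. x \<ge> l)"
    by (rule QBA_class_subsetI) (use rescale in blast)
qed

theorem theorem5:
  shows "(\<forall>\<mu> l::real. 0 < \<mu> \<and> \<mu> < 1 \<and> 0 < l \<and> l < 1 \<longrightarrow>
            QBA_class (\<lambda>x. x > 0) \<subseteq> QBA_class (\<lambda>x. x > \<mu>)
          \<and> QBA_class (\<lambda>x. x > \<mu>) = QBA_class (\<lambda>x. x > l))
       \<and> (\<forall>\<mu> l::real. 0 < \<mu> \<and> \<mu> < 1 \<and> 0 < l \<and> l < 1 \<longrightarrow>
            QBA_class (\<lambda>x. x = 1) \<subseteq> QBA_class (\<lambda>x. x \<ge> \<mu>)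
          \<and> QBA_class (\<lambda>x. x \<ge> \<mu>) = QBA_class (\<lambda>x. x \<ge> l))
       \<and> (\<forall>l::real. 0 \<le> l \<and> l < 1 \<longrightarrow>
            \<not> QBA_class (\<lambda>x. x = 1) \<subseteq> QBA_class (\<lambda>x. x > l))"
proof (intro conjI allI impI; elim conjE)
  fix \<mu> l :: real assume "0 < \<mu>" "\<mu> < 1" "0 < l" "l < 1"
  then show "QBA_class (\<lambda>x. x > 0) \<subseteq> QBA_class (\<lambda>x. x > \<mu>)"
    and "QBA_class (\<lambda>x. x > \<mu>) = QBA_class (\<lambda>x. x > l)"
    by (simp_all add: QBA_class_threshold_subset subset_antisym)
next
  fix \<mu> l :: real assume "0 < \<mu>" "\<mu> < 1" "0 < l" "l < 1"
  have "QBA_class (\<lambda>x. x = 1) = QBA_class (\<lambda>x. x \<ge> 1)"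
    by (rule QBA_class_cong) auto
  with \<open>0 < \<mu>\<close> \<open>\<mu> < 1\<close> show "QBA_class (\<lambda>x. x = 1) \<subseteq> QBA_class (\<lambda>x. x \<ge> \<mu>)"
    by (simp add: QBA_class_threshold_subset)
  show "QBA_class (\<lambda>x. x \<ge> \<mu>) = QBA_class (\<lambda>x. x \<ge> l)"
    using \<open>0 < \<mu>\<close> \<open>\<mu> < 1\<close> \<open>0 < l\<close> \<open>l < 1\<close>
    by (simp add: QBA_class_threshold_subset subset_antisym)
next
  fix l :: real assume "0 \<le> l"
  then show "\<not> QBA_class (\<lambda>x. x = 1) \<subseteq> QBA_class (\<lambda>x. x > l)"
    by (rule QBA_class_eq_1_not_subset_gt)
qed

end
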